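(* Let $\mathscr{H}$ be an $M$-parameter Hamiltonian model on $\mathcal{H}_d\cong\mathbb{C}^d$, let $|\psi_0\rangle\in\mathcal{H}_d$ be a normalized initial state, and fix $\lambda\in\mathbb{R}^M$. Let $|\psi_\lambda(t)\rangle=e^{-it\mathscr{H}(\lambda)}|\psi_0\rangle$ and let $r=\dim\mathcal{Z}(\mathscr{H}(\lambda),|\psi_0\rangle)$. Let $k$ be an integer with $r\le k\le d$, and for $\vec t=(t_1,\dots,t_k)\in\mathbb{R}^k$ let $\mathscr{S}(\vec t):=[\,|\psi_\lambda(t_1)\rangle,\dots,|\psi_\lambda(t_k)\rangle\,]$. Then the set of $\vec t\in\mathbb{R}^k$ for which the vectors in $\mathscr{S}(\vec t)$ span $\mathcal{Z}(\mathscr{H}(\lambda),|\psi_0\rangle)$ is an open and dense subset of $\mathbb{R}^k$ whose complement has Lebesgue measure zero.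
   Context: An $M$-parameter Hamiltonian model is a function $\mathscr{H}(\lambda)=H_0+\sum_{k=1}^M\lambda_kH_k$ of $\lambda\in\mathbb{R}^M$ ($M\ge1$), where $H_0,\dots,H_M$ are fixed self-adjoint operators on the $d$-dimensional complex Hilbert space $\mathcal{H}_d$. For a linear operator $T$ on $\mathcal{H}_d$ and $|\phi\rangle\in\mathcal{H}_d$, the $T$-cyclic subspace generated by $|\phi\rangle$ is $\mathcal{Z}(T,|\phi\rangle):=\mathrm{span}\{T^k|\phi\rangle : k\ge0\}$. *)

theory Defs
  imports "HOL-Analysis.Analysis"
begin

text \<open>
  The Hilbert space of dimension \<open>d\<close> is \<open>complex ^ 'd\<close> with \<open>d = CARD('d)\<close>. Complex scalar
  multiplication is \<open>(*s)\<close>, and the constants \<open>vec.span\<close>, \<open>vec.dim\<close> refer to this complex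
  structure; the unqualified \<open>span\<close>, \<open>dim\<close> would be the real ones.
\<close>

definition cinner :: "complex ^ 'd \<Rightarrow> complex ^ 'd \<Rightarrow> complex" where
  "cinner x y = (\<Sum>i\<in>UNIV. cnj (x $ i) * y $ i)"

definition self_adjoint :: "(complex ^ 'd \<Rightarrow> complex ^ 'd) \<Rightarrow> bool" where
  "self_adjoint T \<longleftrightarrow>
     Vector_Spaces.linear (*s) (*s) T \<and> (\<forall>x y. cinner (T x) y = cinner x (T y))"

definition hamiltonian_model :: "(real ^ 'm \<Rightarrow> complex ^ 'd \<Rightarrow> complex ^ 'd) \<Rightarrow> bool" where
  "hamiltonian_model H \<longleftrightarrow>
     (\<exists>H0 Hs. self_adjoint H0 \<and> (\<forall>k. self_adjoint (Hs k)) \<and>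
        (\<forall>l v. H l v = H0 v + (\<Sum>k\<in>UNIV. complex_of_real (l $ k) *s Hs k v)))"

definition cyclic_subspace ::
    "(complex ^ 'd \<Rightarrow> complex ^ 'd) \<Rightarrow> complex ^ 'd \<Rightarrow> (complex ^ 'd) set" where
  "cyclic_subspace T \<phi> = vec.span {(T ^^ n) \<phi> | n. True}"

text \<open>
  The exponential series of an operator, evaluated at a vector. For linear \<open>T\<close> it converges in
  the operator norm, hence pointwise with the same limit, as the dimension is finite.
\<close>

definition op_exp :: "(complex ^ 'd \<Rightarrow> complex ^ 'd) \<Rightarrow> complex ^ 'd \<Rightarrow> complex ^ 'd" where
  "op_exp T v = (\<Sum>n. (1 / fact n) *s (T ^^ n) v)"

definition evolved_state ::
    "(complex ^ 'd \<Rightarrow> complex ^ 'd) \<Rightarrow> complex ^ 'd \<Rightarrow> real \<Rightarrow> complex ^ 'd" where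
  "evolved_state T \<psi>0 t = op_exp (\<lambda>v. (- (\<i> * complex_of_real t)) *s T v) \<psi>0"

definition snapshots ::
    "(complex ^ 'd \<Rightarrow> complex ^ 'd) \<Rightarrow> complex ^ 'd \<Rightarrow> real ^ 'k \<Rightarrow> 'k \<Rightarrow> complex ^ 'd" where
  "snapshots T \<psi>0 t j = evolved_state T \<psi>0 (t $ j)"

end

(*
  Let psi be the evolved curve and Z the cyclic subspace. For nonzero w in Z the function
  <w, psi(s)> is the restriction of an entire function whose Taylor coefficients are nonzero
  multiples of <w, T^n psi0>, so it is not identically 0 and has only countably many zeros.
  A tuple t is bad iff some unit vector w in Z is orthogonal to all snapshots; since the unit
  sphere of Z is compact, the bad set is closed. The span at a bad t has dimension below
  dim Z <= k, so some snapshot psi(t_j) lies in the span of the others. Fix the other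
  times: if they admit a bad t_j at all, then some w in Z is orthogonal to the other snapshots,
  and every such t_j is a zero of <w, psi(s)>. So each slice in direction j is countable, and by
  Tonelli the bad set is null; the complement of a null set is dense.
*)

theory Submission
  imports Defs "HOL-Complex_Analysis.Conformal_Mappings"
begin

unbundle no fps_syntax

section \<open>Null sets with countable slices\<close>

text \<open>
  By translation invariance the integral over \<open>s\<close> of the measure of \<open>B - s *\<^sub>R e\<close> is
  \<open>\<infinity> * emeasure lborel B\<close>; exchanging the integrals gives \<open>0\<close>.
\<close>

lemma null_sets_lborel_countable_slices:
  fixes B :: "'a::euclidean_space set"
  assumes [measurable]: "B \<in> sets borel"
    and slices: "\<And>x. countable {s::real. x + s *\<^sub>R e \<in> B}"
  shows "B \<in> null_sets lborel"
proof -
  have "(\<integral>\<^sup>+ x. indicator B (x + s *\<^sub>R e) \<partial>lborel) = emeasure lborel B" for s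
  proof -
    have "emeasure lborel B = (\<integral>\<^sup>+ x. indicator B x \<partial>distr lborel borel ((+) (s *\<^sub>R e)))"
      using assms(1) by (simp add: lborel_distr_plus)
    also have "\<dots> = (\<integral>\<^sup>+ x. indicator B (x + s *\<^sub>R e) \<partial>lborel)"
      by (subst nn_integral_distr) (auto simp: add.commute)
    finally show ?thesis ..
  qed
  then have "emeasure lborel B * emeasure lborel (UNIV :: real set)
      = (\<integral>\<^sup>+ s. (\<integral>\<^sup>+ x. indicator B (x + s *\<^sub>R e) \<partial>lborel) \<partial>(lborel :: real measure))"
    by simp
  also have "\<dots> = (\<integral>\<^sup>+ x. (\<integral>\<^sup>+ s. indicator B (x + s *\<^sub>R e) \<partial>lborel) \<partial>lborel)"
    by (intro lborel_pair.Fubini') measurable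
  also have "\<dots> = (\<integral>\<^sup>+ x. 0 \<partial>(lborel :: 'a measure))"
  proof (intro nn_integral_cong)
    fix x :: 'a
    have "(\<integral>\<^sup>+ s. indicator B (x + s *\<^sub>R e) \<partial>lborel)
        = (\<integral>\<^sup>+ s. indicator {s::real. x + s *\<^sub>R e \<in> B} s \<partial>lborel)"
      by (intro nn_integral_cong) (simp add: indicator_def)
    also have "\<dots> = emeasure lborel {s::real. x + s *\<^sub>R e \<in> B}"
      by (intro nn_integral_indicator) measurable
    also have "\<dots> = 0"
      by (rule emeasure_lborel_countable[OF slices])
    finally show "(\<integral>\<^sup>+ s. indicator B (x + s *\<^sub>R e) \<partial>lborel) = 0" .
  qed
  finally have "emeasure lborel B = 0"
    by (auto simp: ennreal_mult_eq_top_iff)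
  then show ?thesis
    using assms(1) by (auto simp: null_sets_def)
qed

section \<open>Complex vectors\<close>

lemma of_real_vector_smult: "complex_of_real r *s v = r *\<^sub>R v"
  by (simp add: vec_eq_iff scaleR_conv_of_real[symmetric])

lemma norm_vector_smult: "norm (c *s v) = norm c * norm (v :: complex ^ 'd)"
  by (simp add: norm_vec_def norm_mult L2_set_right_distrib[symmetric])

lemma cinner_smult_right: "cinner w (c *s v) = c * cinner w v"
  by (simp add: cinner_def sum_distrib_left mult_ac)

lemma cinner_add_right: "cinner w (u + v) = cinner w u + cinner w v"
  by (simp add: cinner_def algebra_simps sum.distrib)

lemma cinner_smult_left: "cinner (c *s w) v = cnj c * cinner w v"
  by (simp add: cinner_def sum_distrib_left mult_ac)

lemma inner_eq_Re_cinner: "inner w v = Re (cinner w v)"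
  by (simp add: inner_vec_def cinner_def inner_complex_def)

lemma cinner_axis: "cinner (axis i 1) v = v $ i"
proof -
  have "cinner (axis i 1) v = (\<Sum>j\<in>UNIV. if j = i then v $ j else 0)"
    unfolding cinner_def by (intro sum.cong) (auto simp: axis_def)
  then show ?thesis by simp
qed

lemma cinner_self_eq_0: "cinner w w = 0 \<Longrightarrow> w = 0"
  by (metis inner_eq_Re_cinner inner_eq_zero_iff zero_complex.sel(1))

lemma bounded_linear_cinner: "bounded_linear (cinner w)"
  unfolding linear_conv_bounded_linear[symmetric]
  by (rule linearI) (simp_all add: cinner_add_right cinner_smult_right
      flip: of_real_vector_smult scaleR_conv_of_real)

lemma cinner_span_eq_0:
  assumes "v \<in> vec.span S" "\<And>u. u \<in> S \<Longrightarrow> cinner w u = 0"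
  shows "cinner w v = 0"
  using assms(1)
  by (induction rule: vec.span_induct_alt)
    (simp_all add: assms cinner_add_right cinner_smult_right, simp add: cinner_def)

text \<open>A complex span is closed under real scalars. This makes the real theory of closed
  subspaces and orthogonal complements applicable to it.\<close>

lemma subspace_vec_span: "subspace (vec.span (S :: (complex ^ 'd) set))"
  unfolding subspace_def
  by (auto simp: vec.span_zero vec.span_add vec.span_scale simp flip: of_real_vector_smult)

lemma closed_vec_span: "closed (vec.span (S :: (complex ^ 'd) set))"
  by (intro closed_subspace subspace_vec_span)

text \<open>The real orthogonal complement supplies \<open>w\<close> with Re \<langle>w, v\<rangle>
  = 0 on the smaller span. That span is stable under multiplication by \<i>, and Re \<langle>w,
  \<i>v\<rangle> = - Im \<langle>w, v\<rangle>, so the imaginary part vanishes too.\<close>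

lemma cinner_orthogonal_exists:
  fixes S T :: "(complex ^ 'd) set"
  assumes "vec.span S \<subset> vec.span T"
  obtains w where "w \<noteq> 0" "w \<in> vec.span T" "\<And>v. v \<in> vec.span S \<Longrightarrow> cinner w v = 0"
proof -
  have sp: "span (vec.span X) = vec.span X" for X :: "(complex ^ 'd) set"
    using subspace_vec_span by (simp add: span_eq_iff)
  obtain w where w: "w \<noteq> 0" "w \<in> vec.span T" "\<And>v. v \<in> vec.span S \<Longrightarrow> orthogonal w v"
    using orthogonal_to_subspace_exists_gen[of "vec.span S" "vec.span T"] assms
    unfolding sp by blast
  have "cinner w v = 0" if v: "v \<in> vec.span S" for v
  proof -
    have "Re (cinner w v) = 0" "Re (cinner w (\<i> *s v)) = 0"
      using w(3)[OF v] w(3)[OF vec.span_scale[OF v]]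
      by (simp_all add: orthogonal_def inner_eq_Re_cinner)
    then show ?thesis
      by (simp add: cinner_smult_right complex_eq_iff)
  qed
  with w show thesis by (intro that)
qed

text \<open>Coefficients are indexed by the whole type, entries outside \<open>I\<close> being
  ignored, so that they range over a Euclidean space whose closed balls are compact.\<close>

lemma vec_span_indexed:
  fixes f :: "'k::finite \<Rightarrow> complex ^ 'd"
  shows "v \<in> vec.span (f ` I) \<longleftrightarrow> (\<exists>c :: complex ^ 'k. v = (\<Sum>i\<in>I. (c $ i) *s f i))"
proof
  assume "v \<in> vec.span (f ` I)"
  then show "\<exists>c :: complex ^ 'k. v = (\<Sum>i\<in>I. (c $ i) *s f i)"
  proof (induction rule: vec.span_induct_alt)
    case base
    show ?case by (intro exI[of _ 0]) simp
  next
    case (step a x y)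
    then obtain j c where *: "j \<in> I" "x = f j" "y = (\<Sum>i\<in>I. (c $ i) *s f i)"
      by auto
    have "(\<Sum>i\<in>I. axis j a $ i *s f i) = (\<Sum>i\<in>I. if i = j then a *s f j else 0)"
      by (intro sum.cong) (auto simp: axis_def)
    then have "a *s x + y = (\<Sum>i\<in>I. ((axis j a + c) $ i) *s f i)"
      using * by (simp add: vec.scale_left_distrib sum.distrib)
    then show ?case by blast
  qed
next
  assume "\<exists>c :: complex ^ 'k. v = (\<Sum>i\<in>I. (c $ i) *s f i)"
  then show "v \<in> vec.span (f ` I)"
    by (elim exE) (simp add: vec.span_sum vec.span_scale vec.span_base)
qed

section \<open>The evolved state\<close>

text \<open>Linearity moves \<open>z\<close> out of the iterates, which leaves a power series in
  \<open>z\<close>. A bound \<open>K\<close> on \<open>T\<close> dominates its terms by those of the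
  exponential series at \<open>norm z * K\<close>.\<close>

lemma op_exp_sums:
  fixes T :: "complex ^ 'd \<Rightarrow> complex ^ 'd"
  assumes T: "Vector_Spaces.linear (*s) (*s) T"
  shows "(\<lambda>n. (z ^ n / fact n) *s (T ^^ n) v) sums op_exp (\<lambda>v. z *s T v) v"
proof -
  interpret T: Vector_Spaces.linear "(*s)" "(*s)" T by (fact T)
  have pow: "((\<lambda>v. z *s T v) ^^ n) v = z ^ n *s (T ^^ n) v" for n
    by (induction n) (simp_all add: T.scale mult.commute)
  have "linear T"
    by (rule linearI) (simp_all add: T.add T.scale flip: of_real_vector_smult)
  then obtain K where K0: "0 \<le> K" and K: "norm (T x) \<le> norm x * K" for x
    using bounded_linear.nonneg_bounded[of T] by (auto simp: linear_conv_bounded_linear)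
  have Tn: "norm ((T ^^ n) v) \<le> K ^ n * norm v" for n
  proof (induction n)
    case (Suc n)
    have "norm ((T ^^ Suc n) v) \<le> norm ((T ^^ n) v) * K"
      using K by simp
    also have "\<dots> \<le> K ^ n * norm v * K"
      using Suc K0 by (intro mult_right_mono)
    finally show ?case by (simp add: mult_ac)
  qed simp
  have "summable (\<lambda>n. (z ^ n / fact n) *s (T ^^ n) v)"
  proof (rule summable_comparison_test)
    have "norm ((z ^ n / fact n) *s (T ^^ n) v) \<le> inverse (fact n) * (norm z * K) ^ n * norm v" for n
      using mult_left_mono[OF Tn[of n], of "norm z ^ n / fact n"]
      by (simp add: norm_vector_smult norm_divide norm_power power_mult_distrib field_simps)
    then show "\<exists>N. \<forall>n\<ge>N. norm ((z ^ n / fact n) *s (T ^^ n) v)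
        \<le> inverse (fact n) * (norm z * K) ^ n * norm v"
      by blast
    show "summable (\<lambda>n. inverse (fact n) * (norm z * K) ^ n * norm v)"
      by (intro summable_mult2 summable_exp)
  qed
  then show ?thesis
    unfolding op_exp_def pow by (simp add: summable_sums)
qed

lemma cinner_op_exp_sums:
  assumes "Vector_Spaces.linear (*s) (*s) T"
  shows "(\<lambda>n. (cinner w ((T ^^ n) v) / fact n) * z ^ n) sums cinner w (op_exp (\<lambda>v. z *s T v) v)"
  using bounded_linear.sums[OF bounded_linear_cinner op_exp_sums[OF assms]]
  by (simp add: cinner_smult_right mult_ac)

text \<open>The power series converges on every ball around 0, and each \<open>z\<close> lies in the
  ball of radius \<open>norm z + 1\<close>.\<close>

lemma cinner_op_exp_holomorphic:
  assumes "Vector_Spaces.linear (*s) (*s) T"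
  shows "(\<lambda>z. cinner w (op_exp (\<lambda>v. z *s T v) v)) holomorphic_on S"
proof -
  have "(\<lambda>z. cinner w (op_exp (\<lambda>v. z *s T v) v)) holomorphic_on ball 0 r" for r
    by (rule power_series_holomorphic) (simp, rule cinner_op_exp_sums[OF assms])
  then have "(\<lambda>z. cinner w (op_exp (\<lambda>v. z *s T v) v)) field_differentiable at z" for z
    using holomorphic_on_imp_differentiable_at[of _ "ball 0 (norm z + 1)" z] by simp
  then show ?thesis
    by (simp add: holomorphic_on_def field_differentiable_at_within)
qed

lemma continuous_on_evolved_state:
  assumes "Vector_Spaces.linear (*s) (*s) T"
  shows "continuous_on S (evolved_state T v)"
proof -
  have "continuous_on S (\<lambda>t. evolved_state T v t $ i)" for i
  proof -
    have "continuous_on UNIV (\<lambda>z. op_exp (\<lambda>v. z *s T v) v $ i)"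
      using holomorphic_on_imp_continuous_on[OF
          cinner_op_exp_holomorphic[OF assms, of "axis i 1" v UNIV]]
      by (simp add: cinner_axis)
    then show ?thesis
      unfolding evolved_state_def
      by (rule continuous_on_compose2[where f = "\<lambda>t. - (\<i> * complex_of_real t)"])
        (auto intro!: continuous_intros)
  qed
  then have "continuous_on S (\<lambda>t. \<chi> i. evolved_state T v t $ i)"
    by (rule continuous_on_vec_lambda)
  then show ?thesis by simp
qed

text \<open>The partial sums of the exponential series lie in the cyclic subspace, which is
  closed.\<close>

lemma evolved_state_in_cyclic_subspace:
  assumes "Vector_Spaces.linear (*s) (*s) T"
  shows "evolved_state T v t \<in> cyclic_subspace T v"
proof -
  have "(\<lambda>N. \<Sum>n<N. ((- (\<i> * of_real t)) ^ n / fact n) *s (T ^^ n) v)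
      \<longlonglongrightarrow> evolved_state T v t"
    using op_exp_sums[OF assms] unfolding sums_def evolved_state_def by blast
  moreover have "(\<Sum>n<N. ((- (\<i> * of_real t)) ^ n / fact n) *s (T ^^ n) v)
      \<in> cyclic_subspace T v" for N
    unfolding cyclic_subspace_def
    by (intro vec.span_sum vec.span_scale vec.span_base) blast
  ultimately show ?thesis
    unfolding cyclic_subspace_def by (rule closed_sequentially[OF closed_vec_span, rotated])
qed

lemma countable_zeros_evolved_state:
  assumes T: "Vector_Spaces.linear (*s) (*s) T"
    and w: "w \<in> cyclic_subspace T v" "w \<noteq> 0"
  shows "countable {t. cinner w (evolved_state T v t) = 0}"
proof -
  define f where "f = (\<lambda>z. cinner w (op_exp (\<lambda>v. z *s T v) v))"
  have sums: "(\<lambda>n. (cinner w ((T ^^ n) v) / fact n) * z ^ n) sums f z" for z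
    unfolding f_def by (rule cinner_op_exp_sums[OF T])
  have "countable {z. f z = 0}"
  \<comment> \<open>The countability of zeros of a holomorphic function is for nonconstant
    functions, so a constant \<open>f\<close> is shown to be nonzero separately.\<close>
  proof (cases "f constant_on UNIV")
    case True
    then obtain c where c: "\<And>z. f z = c"
      by (auto simp: constant_on_def)
    have "c \<noteq> 0"
    proof
      assume "c = 0"
      have coeffs: "cinner w ((T ^^ n) v) = 0" for n
      proof (rule ccontr)
        assume n: "cinner w ((T ^^ n) v) \<noteq> 0"
        \<comment> \<open>The constant coefficient is \<open>f 0\<close>, which is 0. A nonzero
          coefficient thus has positive index and makes the zero at the origin isolated.\<close>
        have "cinner w ((T ^^ 0) v) / fact 0 = f 0"
          using sums[of 0] by (simp only: powser_sums_zero_iff)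
        with n c \<open>c = 0\<close> have "n > 0"
          by (cases n) auto
        then obtain s where "0 < s" "\<And>z. z \<in> cball 0 s - {0} \<Longrightarrow> f z \<noteq> 0"
          using powser_0_nonzero[of 1 0 "\<lambda>n. cinner w ((T ^^ n) v) / fact n" f n]
            sums c \<open>c = 0\<close> n by auto
        then show False
          using c[of "of_real s"] \<open>c = 0\<close> by fastforce
      qed
      have "cinner w w = 0"
        using w(1) unfolding cyclic_subspace_def
        by (rule cinner_span_eq_0) (auto simp: coeffs)
      then show False
        using w(2) cinner_self_eq_0 by blast
    qed
    then show ?thesis by (simp add: c)
  next
    case False
    moreover have "f holomorphic_on UNIV"
      unfolding f_def by (rule cinner_op_exp_holomorphic[OF T])
    ultimately show ?thesis
      using holomorphic_countable_zeros[of f UNIV] connected_UNIV by simp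
  qed
  \<comment> \<open>The zero times embed into the zeros of \<open>f\<close> by the injective map
    from t to -\<i>t.\<close>
  then have "countable ((\<lambda>t. - (\<i> * complex_of_real t)) ` {t. f (- (\<i> * of_real t)) = 0})"
    by (rule countable_subset[rotated]) blast
  then have "countable {t. f (- (\<i> * of_real t)) = 0}"
    by (rule countable_image_inj_on) (simp add: inj_on_def)
  then show ?thesis
    by (simp add: f_def evolved_state_def)
qed

section \<open>Snapshots\<close>

lemma continuous_on_snapshots:
  assumes "Vector_Spaces.linear (*s) (*s) T"
  shows "continuous_on S (\<lambda>t. snapshots T v t j)"
  unfolding snapshots_def
  by (rule continuous_on_compose2[OF continuous_on_evolved_state[OF assms, of UNIV]])
    (auto intro!: continuous_intros)

lemma span_snapshots_subset:
  assumes "Vector_Spaces.linear (*s) (*s) T"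
  shows "vec.span (range (snapshots T v t)) \<subseteq> cyclic_subspace T v"
  unfolding cyclic_subspace_def
  by (rule vec.span_minimal)
    (use evolved_state_in_cyclic_subspace[OF assms] in
      \<open>auto simp: snapshots_def cyclic_subspace_def vec.subspace_span\<close>)

text \<open>A proper subspace of the cyclic subspace has a nonzero orthogonal vector there;
  normalizing it makes the witnesses range over a compact set. Conversely, if the snapshots spanned
  everything, \<open>w\<close> would be orthogonal to itself.\<close>

lemma span_snapshots_neq_iff:
  assumes "Vector_Spaces.linear (*s) (*s) T"
  shows "vec.span (range (snapshots T v t)) \<noteq> cyclic_subspace T v \<longleftrightarrow>
    (\<exists>w \<in> cyclic_subspace T v \<inter> sphere 0 1. \<forall>j. cinner w (snapshots T v t j) = 0)"
    (is "?S \<noteq> ?Z \<longleftrightarrow> ?R")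
proof
  assume "?S \<noteq> ?Z"
  then have "?S \<subset> ?Z"
    using span_snapshots_subset[OF assms] by blast
  then obtain w where w: "w \<noteq> 0" "w \<in> ?Z" "\<And>u. u \<in> ?S \<Longrightarrow> cinner w u = 0"
    unfolding cyclic_subspace_def by (elim cinner_orthogonal_exists)
      (rule that[unfolded cyclic_subspace_def])
  let ?w = "complex_of_real (inverse (norm w)) *s w"
  have "?w \<in> ?Z \<inter> sphere 0 1"
    using w(1,2) unfolding cyclic_subspace_def
    by (simp add: vec.span_scale norm_vector_smult norm_inverse)
  moreover have "\<forall>j. cinner ?w (snapshots T v t j) = 0"
    using w(3) by (simp add: cinner_smult_left vec.span_base)
  ultimately show ?R by blast
next
  assume ?R
  then obtain w where w: "w \<in> ?Z" "norm w = 1" "\<And>j. cinner w (snapshots T v t j) = 0"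
    by auto
  show "?S \<noteq> ?Z"
  proof
    assume "?S = ?Z"
    then have "cinner w w = 0"
      using w by (auto intro: cinner_span_eq_0[of _ "range (snapshots T v t)"])
    then show False
      using w(2) cinner_self_eq_0 by force
  qed
qed

text \<open>The pairs (w, t) with \<open>w\<close> orthogonal to all snapshots form a closed set,
  and projecting along the compact unit sphere of the cyclic subspace preserves closedness.\<close>

lemma closed_span_snapshots_neq:
  fixes T :: "complex ^ 'd \<Rightarrow> complex ^ 'd"
  assumes "Vector_Spaces.linear (*s) (*s) T"
  shows "closed {t :: real ^ 'k. vec.span (range (snapshots T v t)) \<noteq> cyclic_subspace T v}"
proof -
  let ?Q = "{p :: (complex ^ 'd) \<times> (real ^ 'k).
      \<forall>j. cinner (fst p) (snapshots T v (snd p) j) = 0}"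
  have "continuous_on UNIV (\<lambda>p :: (complex ^ 'd) \<times> (real ^ 'k).
      cinner (fst p) (snapshots T v (snd p) j))" for j
    unfolding cinner_def
    by (intro continuous_intros continuous_on_compose2[OF continuous_on_snapshots[OF assms, of UNIV]])
      auto
  then have "closed ?Q"
    by (intro closed_Collect_all closed_Collect_eq) auto
  moreover have "compact (cyclic_subspace T v \<inter> sphere 0 1)"
    unfolding cyclic_subspace_def by (intro closed_Int_compact closed_vec_span) simp
  ultimately show ?thesis
    using closed_compact_projection[of "cyclic_subspace T v \<inter> sphere 0 1" ?Q]
    unfolding span_snapshots_neq_iff[OF assms] by (simp add: Bex_def)
qed

text \<open>Restricting the coefficients to the closed ball of radius \<open>n\<close> gives a
  closed set, as a projection along a compact factor. The union over all \<open>n\<close> is then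
  Borel.\<close>

lemma borel_snapshot_in_span_others:
  fixes T :: "complex ^ 'd \<Rightarrow> complex ^ 'd" and j :: "'k::finite"
  assumes "Vector_Spaces.linear (*s) (*s) T"
  shows "{t. snapshots T v t j \<in> vec.span (snapshots T v t ` (- {j}))} \<in> sets borel"
proof -
  let ?Q = "{p :: (complex ^ 'k) \<times> (real ^ 'k).
      snapshots T v (snd p) j = (\<Sum>i\<in>-{j}. (fst p $ i) *s snapshots T v (snd p) i)}"
  have cont: "continuous_on UNIV (\<lambda>p :: (complex ^ 'k) \<times> (real ^ 'k). snapshots T v (snd p) i)" for i
    by (intro continuous_on_compose2[OF continuous_on_snapshots[OF assms, of UNIV]]
        continuous_intros) auto
  have "continuous_on UNIV (\<lambda>p :: (complex ^ 'k) \<times> (real ^ 'k).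
      \<Sum>i\<in>-{j}. (fst p $ i) *s snapshots T v (snd p) i)"
    unfolding vector_scalar_mult_def
    by (intro continuous_intros continuous_on_vec_lambda cont)
  then have "closed ?Q"
    by (intro closed_Collect_eq cont)
  then have "closed {t. \<exists>c. c \<in> cball 0 (real n) \<and> (c, t) \<in> ?Q}" for n
    by (intro closed_compact_projection) simp_all
  moreover have "{t. snapshots T v t j \<in> vec.span (snapshots T v t ` (- {j}))}
      = (\<Union>n. {t. \<exists>c. c \<in> cball 0 (real n) \<and> (c, t) \<in> ?Q})"
    unfolding vec_span_indexed using real_arch_simple[of "norm _"] by fastforce
  ultimately show ?thesis
    by auto
qed

lemma exists_in_span_of_others:
  fixes f :: "'k::finite \<Rightarrow> complex ^ 'd"
  assumes "vec.dim (range f) < CARD('k)"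
  shows "\<exists>j. f j \<in> vec.span (f ` (- {j}))"
proof -
  obtain B where B: "B \<subseteq> range f" "range f \<subseteq> vec.span B" "card B = vec.dim (range f)"
    by (rule vec.basis_exists)
  \<comment> \<open>\<open>inv f\<close> picks one index for each basis vector. Some index
    \<open>j\<close> is left over, and the basis is found among the values at the other
    indices.\<close>
  have "card (inv f ` B) < CARD('k)"
    using B assms card_image_le[of B "inv f"] finite_subset[OF B(1)] by simp
  then have "inv f ` B \<noteq> UNIV"
    by auto
  then obtain j where j: "j \<notin> inv f ` B"
    by blast
  have "B \<subseteq> f ` (- {j})"
  proof
    fix b assume "b \<in> B"
    with B(1) j show "b \<in> f ` (- {j})"
      by (intro image_eqI[of _ _ "inv f b"]) (auto simp: f_inv_into_f)
  qed
  then have "f j \<in> vec.span (f ` (- {j}))"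
    using B(2) vec.span_mono by blast
  then show ?thesis ..
qed

lemma null_sets_span_snapshots_neq:
  fixes T :: "complex ^ 'd \<Rightarrow> complex ^ 'd"
  assumes T: "Vector_Spaces.linear (*s) (*s) T"
    and dim: "vec.dim (cyclic_subspace T v) \<le> CARD('k)"
  shows "{t :: real ^ 'k. vec.span (range (snapshots T v t)) \<noteq> cyclic_subspace T v}
    \<in> null_sets lborel"
proof -
  define bad where
    "bad = {t :: real ^ 'k. vec.span (range (snapshots T v t)) \<noteq> cyclic_subspace T v}"
  \<comment> \<open>Sorting the bad tuples by an index \<open>j\<close> of a dependent snapshot
    fixes the direction in which \<open>B j\<close> is sliced.\<close>
  define B where
    "B j = bad \<inter> {t. snapshots T v t j \<in> vec.span (snapshots T v t ` (- {j}))}" for j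
  have "B j \<in> null_sets lborel" for j
  proof (rule null_sets_lborel_countable_slices)
    have "bad \<in> sets borel"
      unfolding bad_def by (intro borel_closed closed_span_snapshots_neq T)
    then show "B j \<in> sets borel"
      unfolding B_def by (intro sets.Int borel_snapshot_in_span_others T)
    fix t :: "real ^ 'k"
    let ?x = "\<lambda>s. t + s *\<^sub>R axis j 1"
    have other: "snapshots T v (?x s) i = snapshots T v t i" if "i \<noteq> j" for i s
      using that by (simp add: snapshots_def axis_def)
    then have others: "snapshots T v (?x s) ` (- {j}) = snapshots T v t ` (- {j})" for s
      by (intro image_cong) auto
    show "countable {s. ?x s \<in> B j}"
    proof (cases "\<exists>s0. ?x s0 \<in> B j")
      case True
      \<comment> \<open>A single point of the slice provides \<open>w\<close>. It serves for all
        \<open>s\<close>, since moving along axis \<open>j\<close> leaves the other snapshots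
        unchanged.\<close>
      then obtain s0 where "?x s0 \<in> bad"
        unfolding B_def by blast
      then obtain w where w: "w \<in> cyclic_subspace T v" "norm w = 1"
        "\<And>i. cinner w (snapshots T v (?x s0) i) = 0"
        unfolding bad_def span_snapshots_neq_iff[OF T] by auto
      have w0: "cinner w u = 0" if "u \<in> snapshots T v t ` (- {j})" for u
        using that w(3) other by (metis ComplD imageE singletonI)
      have "cinner w (evolved_state T v (t $ j + s)) = 0" if "?x s \<in> B j" for s
      proof -
        have "snapshots T v (?x s) j \<in> vec.span (snapshots T v (?x s) ` (- {j}))"
          using that unfolding B_def by blast
        then have "cinner w (snapshots T v (?x s) j) = 0"
          unfolding others by (rule cinner_span_eq_0) (rule w0)
        then show ?thesis
          by (simp add: snapshots_def)
      qed
      then have "(\<lambda>s. t $ j + s) ` {s. ?x s \<in> B j} \<subseteq> {s. cinner w (evolved_state T v s) = 0}"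
        by blast
      moreover have "countable {s. cinner w (evolved_state T v s) = 0}"
        using w by (intro countable_zeros_evolved_state[OF T]) auto
      ultimately have "countable ((\<lambda>s. t $ j + s) ` {s. ?x s \<in> B j})"
        by (rule countable_subset)
      then show ?thesis
        by (rule countable_image_inj_on) (auto simp: inj_on_def)
    qed auto
  qed
  moreover have "bad = (\<Union>j. B j)"
  proof -
    have "t \<in> (\<Union>j. B j)" if t: "t \<in> bad" for t
    proof -
      have "vec.span (range (snapshots T v t)) \<subset> cyclic_subspace T v"
        using t span_snapshots_subset[OF T] unfolding bad_def by blast
      \<comment> \<open>A proper subspace has smaller dimension than the cyclic subspace, hence
        fewer than the number of snapshots, which forces a dependence.\<close>
      then have "vec.dim (range (snapshots T v t)) < CARD('k)"
        using vec.dim_psubset[of "range (snapshots T v t)" "{(T ^^ n) v |n. True}"] dim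
        unfolding cyclic_subspace_def by simp
      then show ?thesis
        using exists_in_span_of_others t unfolding B_def by blast
    qed
    then show ?thesis
      unfolding B_def by blast
  qed
  ultimately show ?thesis
    unfolding bad_def[symmetric] by (auto intro: null_sets_UN')
qed

text \<open>The interior of a null set is open and null, hence empty.\<close>

lemma closure_Compl_null_set:
  fixes N :: "'a::euclidean_space set"
  assumes "N \<in> null_sets lborel"
  shows "closure (- N) = UNIV"
proof -
  have "interior N = {}"
    using assms null_sets_completionI[OF assms] negligible_iff_null_sets
      open_not_negligible[OF open_interior] negligible_subset[OF _ interior_subset] by metis
  then show ?thesis
    by (simp add: closure_complement)
qed

lemma hamiltonian_model_linear:
  assumes "hamiltonian_model H"
  shows "Vector_Spaces.linear (*s) (*s) (H l)"
proof -
  obtain H0 Hs where H: "Vector_Spaces.linear (*s) (*s) H0"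
    "\<And>k. Vector_Spaces.linear (*s) (*s) (Hs k)"
    "H l = (\<lambda>v. H0 v + (\<Sum>k\<in>UNIV. complex_of_real (l $ k) *s Hs k v))"
    using assms unfolding hamiltonian_model_def self_adjoint_def by blast
  show ?thesis
    unfolding H(3)
    by (intro vec.linear_compose_add vec.linear_compose_sum vec.linear_compose_scale_right H ballI)
qed

theorem theorem4p4:
  fixes H :: "real ^ 'm \<Rightarrow> complex ^ 'd \<Rightarrow> complex ^ 'd"
    and \<psi>0 :: "complex ^ 'd"
    and l :: "real ^ 'm"
    and good :: "(real ^ 'k) set"
  assumes "hamiltonian_model H"
    and "norm \<psi>0 = 1"
    and "vec.dim (cyclic_subspace (H l) \<psi>0) \<le> CARD('k)"
    and "CARD('k) \<le> CARD('d)"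
  defines "good \<equiv> {t. vec.span (range (snapshots (H l) \<psi>0 t)) = cyclic_subspace (H l) \<psi>0}"
  shows "open good \<and> closure good = UNIV \<and> - good \<in> null_sets lebesgue"
proof -
  have lin: "Vector_Spaces.linear (*s) (*s) (H l)"
    using assms(1) by (rule hamiltonian_model_linear)
  have bad: "- good = {t. vec.span (range (snapshots (H l) \<psi>0 t)) \<noteq> cyclic_subspace (H l) \<psi>0}"
    unfolding good_def by blast
  have "open good"
    unfolding open_closed bad by (rule closed_span_snapshots_neq[OF lin])
  moreover have null: "- good \<in> null_sets lborel"
    unfolding bad by (rule null_sets_span_snapshots_neq[OF lin assms(3)])
  ultimately show ?thesis
    using closure_Compl_null_set[OF null] null_sets_completionI[OF null] by simp
qed

end
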